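(* Let $T>0$ and let the growth condition (defined in the context) hold for the periodic sequence $\sigma_T$ with $t_k=kT$. The following are equivalent: (i) the impulsive system is strongly UGES over $\mathcal S_{\mathrm{cst}}(T)=\{\sigma_T\}$; (ii) there exist $p\ge1$, $c\ge1$, $\eta\ge0$, $\mu\in(0,1]$ with $\eta+(-\log\mu)>0$, and a functional $\bar V:[0,T]\times X\to\mathbb R_{\ge0}$, Lipschitz on bounded subsets of $X$ uniformly in $\tau$ and continuous in $\tau$, satisfying for all $x\in X$ $$\|x\|^p\le\bar V(\tau,x)\le c\|x\|^p\ \ \forall\tau\in[0,T],\qquad \underline D^+\bar V(\tau,x)\le-\eta\bar V(\tau,x)\ \ \forall\tau\in[0,T),\qquad \bar V(0,Jx)\le\mu\bar V(T,x);$$ (iii) the monodromy $M_T:=JS(T)$ admits a coercive Lipschitz Lyapunov function: there exist $p\ge1$, $\hat c\ge1$, $\hat\mu\in(0,1)$ and $V_d:X\to\mathbb R_{\ge0}$, Lipschitz on bounded subsets of $X$, such that $\|x\|^p\le V_d(x)\le\hat c\|x\|^p$ and $V_d(M_Tx)\le\hat\mu V_d(x)$ for all $x\in X$.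
   Context: Setting. $X$ is a Banach space with norm $\|\cdot\|$; $A:D(A)\subset X\to X$ generates a strongly continuous ($C_0$) semigroup $(S(t))_{t\ge0}$ on $X$; $J\in L(X)$ is bounded, $J\neq0$, $JD(A)\subset D(A)$. For an impulse sequence $\sigma=\{t_k\}_{k\ge1}$ with $t_0:=0<t_1<t_2<\dots$, $t_k\to\infty$, put $\mathbb T_\sigma:=\{t_k:k\ge1\}$. The impulsive system is $\dot x(t)=Ax(t)$ for $t\notin\mathbb T_\sigma$, $x(t)=Jx(t^-)$ for $t\in\mathbb T_\sigma$. Its propagator $U_\sigma(t,s)$, $t\ge s\ge0$, is: $U_\sigma(t,s)=S(t-s)$ if $(s,t]\cap\mathbb T_\sigma=\varnothing$; otherwise, if $t_l<\dots<t_m$ are the impulse times in $(s,t]$, $U_\sigma(t,s)=S(t-t_m)JS(t_m-t_{m-1})J\cdots JS(t_l-s)$. $\kappa_\sigma(t,s):=\#(\mathbb T_\sigma\cap(s,t])$. $\mathcal S_{\mathrm{cst}}(T)$ is the set of sequences with $t_{k+1}-t_k=T$ for all $k\ge0$, i.e. $\{\sigma_T\}$. Strong UGES over a family $\mathcal S$: there exist $M\ge1$, $\alpha>0$, $\rho\in(0,1)$ such that $\|U_\sigma(t,s)\|\le M\rho^{\kappa_\sigma(t,s)}e^{-\alpha(t-s)}$ for all $t\ge s\ge0$ and all $\sigma\in\mathcal S$. Growth condition for $\sigma_T$: there exist a piecewise continuous $g:\mathbb R_{\ge0}\to\mathbb R_{>0}$ bounded below by some $c_0>0$, and $\mu_0>1$,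 such that $\|U_{\sigma_T}(t,s)x\|\le g(t-s)\mu_0^{\kappa_{\sigma_T}(t,s)}\|x\|$ for all $t\ge s\ge0$, $x\in X$, and $\sup_{0\le\tau<T}g(\tau)<\infty$. Functionals. $\bar V$ is Lipschitz on bounded subsets of $X$ uniformly in $\tau$ if for every $r>0$ there is $L_r>0$ with $|\bar V(\tau,x)-\bar V(\tau,y)|\le L_r\|x-y\|$ for all $\|x\|,\|y\|<r$ and all $\tau$ (similarly for $V_d$, without $\tau$). $\underline D^+\bar V(\tau,x):=\liminf_{h\downarrow0}h^{-1}\big(\bar V(\tau+h,S(h)x)-\bar V(\tau,x)\big)$. *)

theory Defs
  imports "HOL-Analysis.Analysis"
begin

definition C0_semigroup :: "(real \<Rightarrow> 'a::banach \<Rightarrow>\<^sub>L 'a) \<Rightarrow> bool" where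
  "C0_semigroup S \<longleftrightarrow>
     S 0 = id_blinfun \<and>
     (\<forall>t\<ge>0. \<forall>s\<ge>0. S (t + s) = S t o\<^sub>L S s) \<and>
     (\<forall>x. ((\<lambda>t. blinfun_apply (S t) x) \<longlongrightarrow> x) (at_right 0))"

text \<open>An unbounded operator is given by its domain \<open>D\<close> together with a total function \<open>A\<close>
  whose values outside \<open>D\<close> are irrelevant.\<close>

definition generates :: "('a::banach \<Rightarrow> 'a) \<Rightarrow> 'a set \<Rightarrow> (real \<Rightarrow> 'a \<Rightarrow>\<^sub>L 'a) \<Rightarrow> bool" where
  "generates A D S \<longleftrightarrow>
     C0_semigroup S \<and>
     D = {x. \<exists>y. ((\<lambda>h. (blinfun_apply (S h) x - x) /\<^sub>R h) \<longlongrightarrow> y) (at_right 0)} \<and>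
     (\<forall>x\<in>D. ((\<lambda>h. (blinfun_apply (S h) x - x) /\<^sub>R h) \<longlongrightarrow> A x) (at_right 0))"

text \<open>The value at index 0 is the initial time, not an impulse time.\<close>

definition impulse_sequence :: "(nat \<Rightarrow> real) \<Rightarrow> bool" where
  "impulse_sequence \<sigma> \<longleftrightarrow> \<sigma> 0 = 0 \<and> strict_mono \<sigma> \<and> filterlim \<sigma> at_top sequentially"

definition impulse_times :: "(nat \<Rightarrow> real) \<Rightarrow> real set" where
  "impulse_times \<sigma> = \<sigma> ` {1..}"

definition impulse_count :: "(nat \<Rightarrow> real) \<Rightarrow> real \<Rightarrow> real \<Rightarrow> nat" where
  "impulse_count \<sigma> t s = card (impulse_times \<sigma> \<inter> {s<..t})"

text \<open>For impulse times \<open>\<tau>\<^sub>1 < \<dots> < \<tau>\<^sub>n\<close> in the list,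
  \<open>S (t - \<tau>\<^sub>n) J S (\<tau>\<^sub>n - \<tau>\<^sub>n\<^sub>-\<^sub>1) J \<dots> J S (\<tau>\<^sub>1 - s)\<close>.\<close>

fun impulsive_product ::
  "(real \<Rightarrow> 'a::banach \<Rightarrow>\<^sub>L 'a) \<Rightarrow> ('a \<Rightarrow>\<^sub>L 'a) \<Rightarrow> real list \<Rightarrow> real \<Rightarrow> real \<Rightarrow> 'a \<Rightarrow>\<^sub>L 'a" where
  "impulsive_product S J [] t s = S (t - s)"
| "impulsive_product S J (\<tau> # \<tau>s) t s = impulsive_product S J \<tau>s t \<tau> o\<^sub>L J o\<^sub>L S (\<tau> - s)"

definition propagator ::
  "(real \<Rightarrow> 'a::banach \<Rightarrow>\<^sub>L 'a) \<Rightarrow> ('a \<Rightarrow>\<^sub>L 'a) \<Rightarrow> (nat \<Rightarrow> real) \<Rightarrow> real \<Rightarrow> real \<Rightarrow> 'a \<Rightarrow>\<^sub>L 'a" where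
  "propagator S J \<sigma> t s =
     impulsive_product S J (sorted_list_of_set (impulse_times \<sigma> \<inter> {s<..t})) t s"

definition constant_dwell_sequences :: "real \<Rightarrow> (nat \<Rightarrow> real) set" where
  "constant_dwell_sequences T = {\<sigma>. impulse_sequence \<sigma> \<and> (\<forall>k. \<sigma> (Suc k) - \<sigma> k = T)}"

definition periodic_sequence :: "real \<Rightarrow> nat \<Rightarrow> real" where
  "periodic_sequence T k = real k * T"

lemma constant_dwell_sequences_eq:
  assumes "T > 0"
  shows "constant_dwell_sequences T = {periodic_sequence T}"
proof -
  have "\<sigma> = periodic_sequence T" if "\<sigma> \<in> constant_dwell_sequences T" for \<sigma>
  proof
    fix k show "\<sigma> k = periodic_sequence T k"
    proof (induction k)
      case 0
      then show ?case using that
        by (simp add: constant_dwell_sequences_def impulse_sequence_def periodic_sequence_def)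
    next
      case (Suc k)
      have "\<sigma> (Suc k) - \<sigma> k = T" using that by (simp add: constant_dwell_sequences_def)
      then show ?case using Suc by (simp add: periodic_sequence_def algebra_simps)
    qed
  qed
  moreover have "filterlim (periodic_sequence T) at_top sequentially"
    unfolding periodic_sequence_def
    using assms by (intro filterlim_at_top_mult_tendsto_pos[OF tendsto_const _ filterlim_real_sequentially])
  ultimately show ?thesis
    using assms
    by (auto simp: constant_dwell_sequences_def impulse_sequence_def periodic_sequence_def
        strict_mono_def algebra_simps)
qed

definition strongly_UGES ::
  "(real \<Rightarrow> 'a::banach \<Rightarrow>\<^sub>L 'a) \<Rightarrow> ('a \<Rightarrow>\<^sub>L 'a) \<Rightarrow> (nat \<Rightarrow> real) set \<Rightarrow> bool" where
  "strongly_UGES S J \<S> \<longleftrightarrow>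
     (\<exists>M \<alpha> \<rho> :: real. M \<ge> 1 \<and> \<alpha> > 0 \<and> 0 < \<rho> \<and> \<rho> < 1 \<and>
        (\<forall>\<sigma>\<in>\<S>. \<forall>s\<ge>0. \<forall>t\<ge>s.
           norm (propagator S J \<sigma> t s) \<le> M * \<rho> ^ impulse_count \<sigma> t s * exp (- \<alpha> * (t - s))))"

text \<open>Finitely many discontinuities in every bounded interval, all of the first kind.\<close>

definition piecewise_continuous_nonneg :: "(real \<Rightarrow> real) \<Rightarrow> bool" where
  "piecewise_continuous_nonneg g \<longleftrightarrow>
     (\<forall>b. finite {t \<in> {0..b}. \<not> continuous (at t within {0..}) g}) \<and>
     (\<forall>t\<ge>0. \<exists>l. (g \<longlongrightarrow> l) (at_right t)) \<and>
     (\<forall>t>0. \<exists>l. (g \<longlongrightarrow> l) (at_left t))"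

definition growth_condition ::
  "(real \<Rightarrow> 'a::banach \<Rightarrow>\<^sub>L 'a) \<Rightarrow> ('a \<Rightarrow>\<^sub>L 'a) \<Rightarrow> real \<Rightarrow> bool" where
  "growth_condition S J T \<longleftrightarrow>
     (\<exists>(g :: real \<Rightarrow> real) (c\<^sub>0 :: real) (\<mu>\<^sub>0 :: real).
        piecewise_continuous_nonneg g \<and> c\<^sub>0 > 0 \<and> (\<forall>t\<ge>0. c\<^sub>0 \<le> g t) \<and> \<mu>\<^sub>0 > 1 \<and>
        (\<forall>s\<ge>0. \<forall>t\<ge>s. \<forall>x.
           norm (blinfun_apply (propagator S J (periodic_sequence T) t s) x)
             \<le> g (t - s) * \<mu>\<^sub>0 ^ impulse_count (periodic_sequence T) t s * norm x) \<and>
        bdd_above (g ` {0..<T}))"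

definition lipschitz_on_bounded :: "('a::banach \<Rightarrow> real) \<Rightarrow> bool" where
  "lipschitz_on_bounded V \<longleftrightarrow> (\<forall>r>0. \<exists>L>0. L-lipschitz_on (ball 0 r) V)"

definition uniformly_lipschitz_on_bounded ::
  "'t set \<Rightarrow> ('t \<Rightarrow> 'a::banach \<Rightarrow> real) \<Rightarrow> bool" where
  "uniformly_lipschitz_on_bounded I V \<longleftrightarrow>
     (\<forall>r>0. \<exists>L>0. \<forall>\<tau>\<in>I. L-lipschitz_on (ball 0 r) (V \<tau>))"

text \<open>Taken in the extended reals, since the lower limit need not be finite.\<close>

definition lower_right_Dini ::
  "(real \<Rightarrow> 'a::banach \<Rightarrow>\<^sub>L 'a) \<Rightarrow> (real \<Rightarrow> 'a \<Rightarrow> real) \<Rightarrow> real \<Rightarrow> 'a \<Rightarrow> ereal" where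
  "lower_right_Dini S V \<tau> x =
     Liminf (at_right 0) (\<lambda>h. ereal ((V (\<tau> + h) (blinfun_apply (S h) x) - V \<tau> x) / h))"

end

theory Submission
  imports Defs
begin

text \<open>
  Both Lyapunov conditions are equivalent to strong UGES because each of the three says that the
  powers of the monodromy \<open>M = J S(T)\<close> decay geometrically,
  \<open>\<parallel>M\<^sup>n x\<parallel> \<le> C q\<^sup>n \<parallel>x\<parallel>\<close> with \<open>q < 1\<close>.

  For strong UGES, the propagator of the periodic sequence over an interval with \<open>n + 1\<close> impulses
  is \<open>S(a) M\<^sup>n J S(b)\<close> with \<open>a, b \<in> [0, T]\<close> (lemma \<open>propagator_periodic\<close>).
  The growth condition bounds \<open>S\<close> on \<open>[0, T]\<close>, so the two outer factors cost only a constant; and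
  since the elapsed time is at most \<open>T\<close> times the number of impulses plus one, half of the
  decay per impulse can be traded for decay in time (lemma \<open>strongly_UGES_iff_monodromy\<close>).

  A functional as in (iii) gives geometric decay by iteration. Conversely
  \<open>W x = sup\<^sub>n q\<^sup>-\<^sup>n \<parallel>M\<^sup>n x\<parallel>\<close> is an equivalent norm that \<open>M\<close> contracts by the factor
  \<open>q\<close> (lemma \<open>contracting_renorming\<close>).

  From (ii) to (iii): along a trajectory of the semigroup the functional is continuous and its lower
  Dini derivative is controlled, so a comparison argument (lemma \<open>comparison_lower_Dini\<close>)
  gives \<open>V(T, S(T)x) \<le> e\<^sup>-\<^sup>\<eta>\<^sup>T V(0, x)\<close>. The jump inequality then turns \<open>V(0, \<cdot>)\<close>
  into a discrete Lyapunov function with factor \<open>\<mu> e\<^sup>-\<^sup>\<eta>\<^sup>T < 1\<close>.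

  From geometric decay to (ii), all the decay is put into the jumps, so \<open>\<eta> = 0\<close>. The functional
  \<open>V(\<tau>, x) = e\<^bsup>\<omega>(T - \<tau>)\<^esup> N(x) + \<beta> W(J S(T - \<tau>) x)\<close>
  looks ahead to the state just after the next impulse. The second summand is constant along
  the flow. The first is coercive and nonincreasing along the flow, where \<open>N\<close> is an equivalent norm
  with \<open>N(S(h)x) \<le> e\<^sup>\<omega>\<^sup>h N(x)\<close> (lemma \<open>semigroup_renorming\<close>). At an impulse the second summand
  contracts, because the new look-ahead state is \<open>M\<close> applied to the old one, and for large
  \<open>\<beta>\<close> this contraction absorbs the increase of the first.
\<close>

section \<open>A comparison principle for lower Dini derivatives\<close>

text \<open>At the last time \<open>s\<close> at which \<open>\<phi> \<le> u\<close> the two functions agree, and beyond \<open>s\<close> all difference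
  quotients of \<open>\<phi>\<close> at \<open>s\<close> dominate those of \<open>u\<close>. Taking the last such time, and not the first
  time of crossing, is what makes the lower limit sufficient.\<close>

lemma comparison_lower_Dini:
  fixes \<phi> u u' :: "real \<Rightarrow> real"
  assumes cont: "continuous_on {a..b} \<phi>"
    and deriv: "\<And>t. (u has_real_derivative u' t) (at t)"
    and init: "\<phi> a \<le> u a"
    and Dini: "\<And>t. t \<in> {a..<b} \<Longrightarrow> \<phi> t = u t \<Longrightarrow>
      Liminf (at_right 0) (\<lambda>h. ereal ((\<phi> (t + h) - \<phi> t) / h)) < ereal (u' t)"
    and t: "t \<in> {a..b}"
  shows "\<phi> t \<le> u t"
proof (rule ccontr)
  assume neg: "\<not> \<phi> t \<le> u t"
  define d where "d r = \<phi> r - u r" for r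
  have cont_u: "continuous_on X u" for X
    using deriv by (meson DERIV_isCont continuous_at_imp_continuous_on)
  have cont_d: "continuous_on {a..t} d"
    unfolding d_def
    by (intro continuous_intros cont_u continuous_on_subset[OF cont]) (use t in auto)
  define B where "B = {r \<in> {a..t}. d r \<le> 0}"
  define s where "s = Sup B"
  have "closed B"
    unfolding B_def by (rule continuous_on_closed_Collect_le[OF cont_d continuous_on_const]) simp
  moreover have "a \<in> B" using init t by (auto simp: B_def d_def)
  moreover have bdd: "bdd_above B" by (auto simp: B_def)
  ultimately have "s \<in> B" unfolding s_def by (intro closed_contains_Sup) auto
  then have s: "a \<le> s" "s \<le> t" "d s \<le> 0" by (auto simp: B_def)
  have pos: "d r > 0" if "s < r" "r \<le> t" for r
  proof (rule ccontr)
    assume "\<not> d r > 0"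
    then have "r \<in> B" using that s by (auto simp: B_def)
    then have "r \<le> s" unfolding s_def using bdd by (rule cSup_upper)
    with that show False by simp
  qed
  have "s < t" using s neg by (cases "s = t") (auto simp: d_def)
  have "\<exists>z\<ge>s. z \<le> t \<and> d z = 0"
    by (rule IVT') (use s \<open>s < t\<close> pos[of t] in \<open>auto intro: continuous_on_subset[OF cont_d]\<close>)
  then obtain z where z: "s \<le> z" "z \<le> t" "d z = 0" by blast
  have "z = s" using pos[of z] z by force
  with z have eq: "\<phi> s = u s" by (simp add: d_def)
  have "eventually (\<lambda>h. h \<in> {0<..<t - s}) (at_right 0)"
    using \<open>s < t\<close> by (intro eventually_at_right_real) simp
  then have ev: "eventually (\<lambda>h. ereal ((u (s + h) - u s) / h) \<le> ereal ((\<phi> (s + h) - \<phi> s) / h))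
      (at_right 0)"
  proof eventually_elim
    case (elim h)
    then have "d (s + h) > 0" by (intro pos) auto
    then show ?case using elim eq by (auto simp: d_def intro!: divide_right_mono)
  qed
  have "((\<lambda>h. (u (s + h) - u s) / h) \<longlongrightarrow> u' s) (at_right 0)"
    using deriv[of s] unfolding DERIV_def by (rule tendsto_mono[rotated]) (simp add: at_le)
  then have "Liminf (at_right 0) (\<lambda>h. ereal ((u (s + h) - u s) / h)) = ereal (u' s)"
    by (intro lim_imp_Liminf) (auto simp: tendsto_ereal)
  with Liminf_mono[OF ev] have "ereal (u' s) \<le> Liminf (at_right 0) (\<lambda>h. ereal ((\<phi> (s + h) - \<phi> s) / h))"
    by simp
  with Dini[of s] s \<open>s < t\<close> t eq show False by auto
qed

text \<open>The exponential bound is compared with the strict supersolutions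
  \<open>(\<phi>(0) + \<epsilon>(1 + t)) e\<^sup>-\<^sup>\<eta>\<^sup>t\<close>, followed by \<open>\<epsilon> \<rightarrow> 0\<close>.\<close>

lemma exponential_decay_lower_Dini:
  fixes \<phi> :: "real \<Rightarrow> real"
  assumes cont: "continuous_on {0..b} \<phi>"
    and Dini: "\<And>t. t \<in> {0..<b} \<Longrightarrow>
      Liminf (at_right 0) (\<lambda>h. ereal ((\<phi> (t + h) - \<phi> t) / h)) \<le> ereal (- \<eta> * \<phi> t)"
    and t: "t \<in> {0..b}"
  shows "\<phi> t \<le> \<phi> 0 * exp (- \<eta> * t)"
proof -
  have bound: "\<phi> t \<le> (\<phi> 0 + e * (1 + t)) * exp (- \<eta> * t)" if "e > 0" for e
  proof (rule comparison_lower_Dini[where u' = "\<lambda>t. - \<eta> * ((\<phi> 0 + e * (1 + t)) * exp (- \<eta> * t))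
        + e * exp (- \<eta> * t)", OF cont _ _ _ t])
    show "((\<lambda>t. (\<phi> 0 + e * (1 + t)) * exp (- \<eta> * t)) has_real_derivative
        - \<eta> * ((\<phi> 0 + e * (1 + r)) * exp (- \<eta> * r)) + e * exp (- \<eta> * r)) (at r)" for r
      by (auto intro!: derivative_eq_intros simp: algebra_simps)
    show "\<phi> 0 \<le> (\<phi> 0 + e * (1 + 0)) * exp (- \<eta> * 0)" using that by simp
    fix r assume r: "r \<in> {0..<b}" and eq: "\<phi> r = (\<phi> 0 + e * (1 + r)) * exp (- \<eta> * r)"
    have "- \<eta> * \<phi> r < - \<eta> * \<phi> r + e * exp (- \<eta> * r)" using that by simp
    then show "Liminf (at_right 0) (\<lambda>h. ereal ((\<phi> (r + h) - \<phi> r) / h))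
      < ereal (- \<eta> * ((\<phi> 0 + e * (1 + r)) * exp (- \<eta> * r)) + e * exp (- \<eta> * r))"
      using Dini[OF r] unfolding eq[symmetric] by (meson le_less_trans less_ereal.simps(1))
  qed
  have "((\<lambda>e. (\<phi> 0 + e * (1 + t)) * exp (- \<eta> * t)) \<longlongrightarrow> (\<phi> 0 + 0 * (1 + t)) * exp (- \<eta> * t)) (at_right 0)"
    by (intro tendsto_intros)
  moreover have "eventually (\<lambda>e. \<phi> t \<le> (\<phi> 0 + e * (1 + t)) * exp (- \<eta> * t)) (at_right 0)"
    using bound by (auto simp: eventually_at_filter)
  ultimately have "\<phi> t \<le> (\<phi> 0 + 0 * (1 + t)) * exp (- \<eta> * t)"
    by (intro tendsto_lowerbound) auto
  then show ?thesis by simp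
qed

section \<open>Equivalent norms given by suprema\<close>

definition sup_norm :: "'i set \<Rightarrow> ('i \<Rightarrow> 'a \<Rightarrow> 'a) \<Rightarrow> 'a::real_normed_vector \<Rightarrow> real" where
  "sup_norm I F x = (SUP i\<in>I. norm (F i x))"

lemma norm_le_sup_norm:
  assumes "\<And>i x. i \<in> I \<Longrightarrow> norm (F i x) \<le> c * norm x" and "i \<in> I"
  shows "norm (F i x) \<le> sup_norm I F x"
  unfolding sup_norm_def using assms by (intro cSUP_upper bdd_aboveI2) auto

lemma sup_norm_le:
  assumes "I \<noteq> {}" and "\<And>i. i \<in> I \<Longrightarrow> norm (F i x) \<le> c"
  shows "sup_norm I F x \<le> c"
  unfolding sup_norm_def using assms by (intro cSUP_least)

lemma sup_norm_triangle:
  assumes "I \<noteq> {}" and "\<And>i x. i \<in> I \<Longrightarrow> norm (F i x) \<le> c * norm x"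
    and "\<And>i. i \<in> I \<Longrightarrow> linear (F i)"
  shows "sup_norm I F x \<le> sup_norm I F y + sup_norm I F (x - y)"
proof (rule sup_norm_le[OF assms(1)])
  fix i assume i: "i \<in> I"
  have "F i x = F i y + F i (x - y)" using linear_diff[OF assms(3)[OF i]] by simp
  then have "norm (F i x) \<le> norm (F i y) + norm (F i (x - y))" by (metis norm_triangle_ineq)
  then show "norm (F i x) \<le> sup_norm I F y + sup_norm I F (x - y)"
    using norm_le_sup_norm[of I F c i y, OF assms(2) i] norm_le_sup_norm[of I F c i "x - y", OF assms(2) i]
    by linarith
qed

lemma lipschitz_if_subadditive:
  fixes f :: "'a::real_normed_vector \<Rightarrow> real"
  assumes "\<And>x y. f x \<le> f y + f (x - y)" and "\<And>x. f x \<le> c * norm x" and "c \<ge> 0"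
  shows "c-lipschitz_on X f"
proof (rule lipschitz_onI)
  fix x y
  show "dist (f x) (f y) \<le> c * dist x y"
    using assms(1)[of x y] assms(1)[of y x] assms(2)[of "x - y"] assms(2)[of "y - x"]
    by (simp add: dist_norm norm_minus_commute abs_le_iff)
qed (fact assms)

lemma linear_funpow:
  fixes f :: "'a::real_vector \<Rightarrow> 'a"
  assumes "linear f"
  shows "linear (f ^^ n)"
  using assms by (induction n) (simp_all add: linear_iff)

text \<open>Weighting the orbit by \<open>q\<^sup>-\<^sup>n\<close> turns geometric decay, which allows transient growth by the factor
  \<open>C\<close>, into a contraction in every single step: applying \<open>M\<close> only shifts the family whose supremum is taken.\<close>

lemma contracting_renorming:
  fixes M :: "'a::real_normed_vector \<Rightarrow> 'a"
  assumes "linear M" and "0 < q" and decay: "\<And>n x. norm ((M ^^ n) x) \<le> C * q ^ n * norm x"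
  obtains W where "\<And>x. norm x \<le> W x" "\<And>x. W x \<le> C * norm x"
    "\<And>x. W (M x) \<le> q * W x" "\<And>x y. W x \<le> W y + W (x - y)"
proof
  define F where "F n x = (1 / q ^ n) *\<^sub>R (M ^^ n) x" for n x
  let ?W = "sup_norm UNIV F"
  have F: "norm (F n x) \<le> C * norm x" for n x
    using decay[of n x] \<open>0 < q\<close> by (simp add: F_def field_simps)
  have lin: "linear (F n)" for n
    unfolding F_def using linear_funpow[OF assms(1)]
    by (rule linear_compose_scale_right)
  show "norm x \<le> ?W x" for x
    using norm_le_sup_norm[of UNIV F C 0 x, OF F] by (simp add: F_def)
  show "?W x \<le> C * norm x" for x
    using F by (intro sup_norm_le) auto
  show "?W (M x) \<le> q * ?W x" for x
  proof (rule sup_norm_le)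
    fix n
    have "norm (F n (M x)) = q * norm (F (Suc n) x)"
      using \<open>0 < q\<close> unfolding F_def funpow_Suc_right by (simp add: field_simps)
    also have "\<dots> \<le> q * ?W x"
      using norm_le_sup_norm[of UNIV F C "Suc n" x, OF F] \<open>0 < q\<close> by simp
    finally show "norm (F n (M x)) \<le> q * ?W x" .
  qed simp
  show "?W x \<le> ?W y + ?W (x - y)" for x y
    by (rule sup_norm_triangle[OF _ F lin]) simp
qed

section \<open>Strongly continuous semigroups on a bounded time interval\<close>

lemma C0_semigroup_0:
  "C0_semigroup S \<Longrightarrow> blinfun_apply (S 0) x = x"
  by (simp add: C0_semigroup_def id_blinfun.rep_eq)

lemma C0_semigroup_add:
  "C0_semigroup S \<Longrightarrow> s \<ge> 0 \<Longrightarrow> t \<ge> 0 \<Longrightarrow>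
    blinfun_apply (S (s + t)) x = blinfun_apply (S s) (blinfun_apply (S t) x)"
  by (simp add: C0_semigroup_def)

text \<open>Right and left continuity follow together, because
  \<open>S(t) - S(s) = S(s)(S(t - s) - I)\<close> for \<open>s \<le> t\<close> and \<open>S(s)\<close> is uniformly bounded.\<close>

lemma C0_semigroup_continuous_on:
  assumes S: "C0_semigroup S" and K: "\<And>t x. t \<in> {0..T} \<Longrightarrow> norm (blinfun_apply (S t) x) \<le> K * norm x"
  shows "continuous_on {0..T} (\<lambda>t. blinfun_apply (S t) x)"
  unfolding continuous_on_iff
proof safe
  fix t e :: real assume t: "t \<in> {0..T}" and e: "e > 0"
  have "((\<lambda>h. K * norm (blinfun_apply (S h) x - x)) \<longlongrightarrow> K * norm (x - x)) (at_right 0)"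
    using S unfolding C0_semigroup_def by (intro tendsto_intros) auto
  then have "eventually (\<lambda>h. K * norm (blinfun_apply (S h) x - x) < e) (at_right 0)"
    using e by (intro order_tendstoD) auto
  then obtain d where d: "d > 0" "\<And>h. 0 < h \<Longrightarrow> h < d \<Longrightarrow> K * norm (blinfun_apply (S h) x - x) < e"
    unfolding eventually_at_right_field by auto
  have close: "dist (blinfun_apply (S v) x) (blinfun_apply (S r) x) < e"
    if "r \<in> {0..T}" "r < v" "v - r < d" for r v
  proof -
    have "blinfun_apply (S v) x = blinfun_apply (S r) (blinfun_apply (S (v - r)) x)"
      using C0_semigroup_add[OF S, of r "v - r" x] that by simp
    then have "dist (blinfun_apply (S v) x) (blinfun_apply (S r) x)
        = norm (blinfun_apply (S r) (blinfun_apply (S (v - r)) x - x))"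
      by (simp add: dist_norm blinfun.diff_right)
    also have "\<dots> \<le> K * norm (blinfun_apply (S (v - r)) x - x)"
      using K that by blast
    also have "\<dots> < e" using d(2) that by simp
    finally show ?thesis .
  qed
  show "\<exists>d>0. \<forall>r\<in>{0..T}. dist r t < d \<longrightarrow> dist (blinfun_apply (S r) x) (blinfun_apply (S t) x) < e"
  proof (intro exI[of _ d] conjI ballI impI d(1))
    fix r assume "r \<in> {0..T}" "dist r t < d"
    then show "dist (blinfun_apply (S r) x) (blinfun_apply (S t) x) < e"
      using close[of r t] close[of t r] t e
      by (cases r t rule: linorder_cases) (auto simp: dist_real_def dist_commute)
  qed
qed

text \<open>With \<open>\<omega> = log K / T\<close> the supremum of \<open>e\<^sup>-\<^sup>\<omega>\<^sup>h \<parallel>S(h)x\<parallel>\<close> over all \<open>h \<ge> 0\<close> equals the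
  one over \<open>[0, T]\<close>, since \<open>e\<^sup>-\<^sup>\<omega>\<^sup>T \<parallel>S(T)\<parallel> \<le> 1\<close>. So the bound on one period suffices for a norm in which
  the semigroup is quasicontractive.\<close>

lemma semigroup_renorming:
  fixes S :: "real \<Rightarrow> 'a::banach \<Rightarrow>\<^sub>L 'a"
  assumes S: "C0_semigroup S" and "T > 0" and "K \<ge> 1"
    and K: "\<And>t x. t \<in> {0..T} \<Longrightarrow> norm (blinfun_apply (S t) x) \<le> K * norm x"
  obtains N :: "'a \<Rightarrow> real" and \<omega> where "\<omega> \<ge> 0" "\<And>x. norm x \<le> N x" "\<And>x. N x \<le> K * norm x"
    "\<And>h x. h \<in> {0..T} \<Longrightarrow> N (blinfun_apply (S h) x) \<le> exp (\<omega> * h) * N x"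
    "\<And>x y. N x \<le> N y + N (x - y)"
proof
  define \<omega> where "\<omega> = ln K / T"
  have "exp (\<omega> * T) = K" using \<open>T > 0\<close> \<open>K \<ge> 1\<close> by (simp add: \<omega>_def)
  show "\<omega> \<ge> 0" using \<open>T > 0\<close> \<open>K \<ge> 1\<close> by (simp add: \<omega>_def)
  define F where "F h x = exp (- \<omega> * h) *\<^sub>R blinfun_apply (S h) x" for h x
  let ?N = "sup_norm {0..T} F"
  have F: "norm (F h x) \<le> K * norm x" if "h \<in> {0..T}" for h x
  proof -
    have "norm (F h x) \<le> 1 * norm (blinfun_apply (S h) x)"
      unfolding F_def norm_scaleR using \<open>\<omega> \<ge> 0\<close> that by (intro mult_right_mono) auto
    with K[OF that, of x] show ?thesis by simp
  qed
  have lin: "linear (F h)" for h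
    unfolding F_def
    by (intro linear_compose_scale_right bounded_linear.linear blinfun.bounded_linear_right)
  show "norm x \<le> ?N x" for x
    using norm_le_sup_norm[of "{0..T}" F K 0 x, OF F] \<open>T > 0\<close> S by (simp add: F_def C0_semigroup_0)
  show "?N x \<le> K * norm x" for x
    using F \<open>T > 0\<close> by (intro sup_norm_le) auto
  show "?N (blinfun_apply (S h) x) \<le> exp (\<omega> * h) * ?N x" if h: "h \<in> {0..T}" for h x
  proof (rule sup_norm_le)
    fix r assume r: "r \<in> {0..T}"
    have shift: "norm (F r (blinfun_apply (S h) x))
        = exp (\<omega> * h) * (exp (- \<omega> * (r + h)) * norm (blinfun_apply (S (r + h)) x))"
      using C0_semigroup_add[OF S, of r h x] r h
      by (simp add: F_def mult.assoc[symmetric] mult_exp_exp algebra_simps)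
    have "exp (- \<omega> * (r + h)) * norm (blinfun_apply (S (r + h)) x) \<le> ?N x"
    proof (cases "r + h \<le> T")
      case True
      then show ?thesis
        using norm_le_sup_norm[of "{0..T}" F K "r + h" x, OF F] r h by (simp add: F_def)
    next
      case False
      define v where "v = r + h - T"
      have v: "v \<in> {0..T}" "r + h = T + v" using False r h by (auto simp: v_def)
      have "exp (- \<omega> * (r + h)) * norm (blinfun_apply (S (r + h)) x)
          = exp (- \<omega> * v) * (norm (blinfun_apply (S T) (blinfun_apply (S v) x)) / K)"
        using C0_semigroup_add[OF S, of T v x] v \<open>T > 0\<close> \<open>exp (\<omega> * T) = K\<close>
        by (simp add: distrib_left exp_diff exp_minus divide_inverse mult_ac)
      also have "\<dots> \<le> exp (- \<omega> * v) * norm (blinfun_apply (S v) x)"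
        using K[of T "blinfun_apply (S v) x"] \<open>T > 0\<close> \<open>K \<ge> 1\<close>
        by (intro mult_left_mono) (auto simp: field_simps)
      also have "\<dots> \<le> ?N x"
        using norm_le_sup_norm[of "{0..T}" F K v x, OF F v(1)] by (simp add: F_def)
      finally show ?thesis .
    qed
    then show "norm (F r (blinfun_apply (S h) x)) \<le> exp (\<omega> * h) * ?N x"
      unfolding shift by simp
  qed (use \<open>T > 0\<close> in auto)
  show "?N x \<le> ?N y + ?N (x - y)" for x y
    using \<open>T > 0\<close> by (intro sup_norm_triangle[OF _ F lin]) auto
qed

section \<open>The propagator of a periodic impulse sequence\<close>

text \<open>The first impulse after \<open>s\<close> has index \<open>\<lfloor>s/T\<rfloor> + 1\<close>, and the interval \<open>(s, t]\<close> is a window of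
  consecutive indices.\<close>

lemma impulse_window:
  assumes "T > 0" and "s \<ge> 0"
  obtains l where "l \<ge> 1" "s < real l * T" "real l * T \<le> s + T"
    "impulse_times (periodic_sequence T) \<inter> {s<..t} = (\<lambda>k. real k * T) ` {k. l \<le> k \<and> real k * T \<le> t}"
proof
  define l where "l = Suc (nat \<lfloor>s / T\<rfloor>)"
  have l: "real l = of_int \<lfloor>s / T\<rfloor> + 1" using assms by (simp add: l_def)
  have "s / T < real l" "real l \<le> s / T + 1" unfolding l by linarith+
  then show sl: "s < real l * T" and "real l * T \<le> s + T"
    using \<open>T > 0\<close> by (auto simp: field_simps)
  then have lower: "real (l - 1) * T \<le> s"
    by (simp add: l_def algebra_simps)
  show "l \<ge> 1" by (simp add: l_def)
  have window: "1 \<le> k \<and> s < real k * T \<longleftrightarrow> l \<le> k" for k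
  proof
    assume k: "1 \<le> k \<and> s < real k * T"
    show "l \<le> k"
    proof (rule ccontr)
      assume "\<not> l \<le> k"
      then have "real k * T \<le> real (l - 1) * T" using \<open>T > 0\<close> by (intro mult_right_mono) auto
      with lower k show False by linarith
    qed
  next
    assume "l \<le> k"
    then have "real l * T \<le> real k * T" using \<open>T > 0\<close> by (intro mult_right_mono) auto
    with sl \<open>l \<ge> 1\<close> \<open>l \<le> k\<close> show "1 \<le> k \<and> s < real k * T" by simp
  qed
  show "impulse_times (periodic_sequence T) \<inter> {s<..t}
      = (\<lambda>k. real k * T) ` {k. l \<le> k \<and> real k * T \<le> t}"
  proof -
    have "impulse_times (periodic_sequence T) \<inter> {s<..t}
        = (\<lambda>k. real k * T) ` {k. (1 \<le> k \<and> s < real k * T) \<and> real k * T \<le> t}"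
      by (auto simp: impulse_times_def periodic_sequence_def)
    then show ?thesis unfolding window .
  qed
qed

lemma impulsive_product_periodic:
  "blinfun_apply (impulsive_product S J (map (\<lambda>k. real k * T) [l..<Suc (l + n)]) t s) x
    = blinfun_apply (S (t - real (l + n) * T))
        ((blinfun_apply (J o\<^sub>L S T) ^^ n) (blinfun_apply J (blinfun_apply (S (real l * T - s)) x)))"
proof (induction n arbitrary: l s x)
  case 0
  then show ?case by simp
next
  case (Suc n)
  have "[l..<Suc (l + Suc n)] = l # [Suc l..<Suc (Suc l + n)]"
    by (simp add: upt_conv_Cons del: upt_Suc)
  moreover have "real (Suc l) * T - real l * T = T" by (simp add: algebra_simps)
  ultimately show ?case
    using Suc.IH[of "Suc l" "real l * T"]
    by (simp add: funpow_Suc_right del: upt_Suc funpow.simps of_nat_Suc)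
qed

lemma propagator_of_window:
  fixes S :: "real \<Rightarrow> 'a::banach \<Rightarrow>\<^sub>L 'a"
  assumes "T > 0"
    and window: "impulse_times (periodic_sequence T) \<inter> {s<..t} = (\<lambda>k. real k * T) ` {l..l + n}"
  shows "impulse_count (periodic_sequence T) t s = Suc n"
    and "blinfun_apply (propagator S J (periodic_sequence T) t s) x
      = blinfun_apply (S (t - real (l + n) * T))
          ((blinfun_apply (J o\<^sub>L S T) ^^ n) (blinfun_apply J (blinfun_apply (S (real l * T - s)) x)))"
proof -
  have "inj_on (\<lambda>k. real k * T) {l..l + n}"
    using \<open>T > 0\<close> by (auto simp: inj_on_def)
  then show "impulse_count (periodic_sequence T) t s = Suc n"
    unfolding impulse_count_def window by (simp add: card_image)
  let ?ks = "map (\<lambda>k. real k * T) [l..<Suc (l + n)]"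
  have "sorted_wrt (<) ?ks"
    unfolding sorted_wrt_map using \<open>T > 0\<close>
    by (intro sorted_wrt_mono_rel[OF _ sorted_wrt_upt]) simp
  then have "sorted ?ks" "distinct ?ks"
    by (simp_all only: strict_sorted_iff)
  then have "sorted_list_of_set (set ?ks) = ?ks"
    by (rule sorted_list_of_set.idem_if_sorted_distinct)
  moreover have "set ?ks = (\<lambda>k. real k * T) ` {l..l + n}"
    by (simp only: set_map set_upt atLeastLessThanSuc_atLeastAtMost)
  ultimately show "blinfun_apply (propagator S J (periodic_sequence T) t s) x
      = blinfun_apply (S (t - real (l + n) * T))
          ((blinfun_apply (J o\<^sub>L S T) ^^ n) (blinfun_apply J (blinfun_apply (S (real l * T - s)) x)))"
    unfolding propagator_def window by (metis impulsive_product_periodic)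
qed

text \<open>The time identity in the second case is what later relates elapsed time to the number of
  impulses: \<open>a\<close> is the time since the last impulse and \<open>b\<close> the time before the first one.\<close>

lemma propagator_periodic:
  fixes S :: "real \<Rightarrow> 'a::banach \<Rightarrow>\<^sub>L 'a"
  assumes "T > 0" and "0 \<le> s" and "s \<le> t"
  shows "impulse_count (periodic_sequence T) t s = 0 \<and> t - s < T \<and>
      propagator S J (periodic_sequence T) t s = S (t - s)
    \<or> (\<exists>n a b. impulse_count (periodic_sequence T) t s = Suc n \<and> a \<in> {0..T} \<and> b \<in> {0..T} \<and>
        t - s = a + real n * T + b \<and>
        (\<forall>x. blinfun_apply (propagator S J (periodic_sequence T) t s) x
          = blinfun_apply (S a) ((blinfun_apply (J o\<^sub>L S T) ^^ n) (blinfun_apply J (blinfun_apply (S b) x)))))"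
proof -
  obtain l where l: "l \<ge> 1" "s < real l * T" "real l * T \<le> s + T"
    and I: "impulse_times (periodic_sequence T) \<inter> {s<..t} = (\<lambda>k. real k * T) ` {k. l \<le> k \<and> real k * T \<le> t}"
    by (rule impulse_window[OF assms(1,2)])
  define m where "m = nat \<lfloor>t / T\<rfloor>"
  have m: "real k * T \<le> t \<longleftrightarrow> k \<le> m" for k
    using assms by (simp add: m_def le_nat_iff le_floor_iff field_simps)
  have tm: "t < real m * T + T"
    using m[of "Suc m"] by (simp add: algebra_simps)
  have I': "impulse_times (periodic_sequence T) \<inter> {s<..t} = (\<lambda>k. real k * T) ` {l..m}"
    unfolding I m by (simp add: atLeastAtMost_def atLeast_def atMost_def Int_def)
  show ?thesis
  proof (cases "l \<le> m")
    case False
    then have "t < real l * T" using m[of l] by simp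
    moreover have "impulse_times (periodic_sequence T) \<inter> {s<..t} = {}" using False I' by simp
    ultimately show ?thesis using l by (simp add: propagator_def impulse_count_def)
  next
    case True
    define n where "n = m - l"
    have mn: "m = l + n" using True by (simp add: n_def)
    note window = propagator_of_window[OF \<open>T > 0\<close> I'[unfolded mn]]
    have "blinfun_apply (propagator S J (periodic_sequence T) t s) x
        = blinfun_apply (S (t - real m * T)) ((blinfun_apply (J o\<^sub>L S T) ^^ n)
            (blinfun_apply J (blinfun_apply (S (real l * T - s)) x)))" for x
      using window(2) by (simp only: mn)
    moreover have "t - real m * T \<in> {0..T}" "real l * T - s \<in> {0..T}"
      using m[of m] tm l by auto
    moreover have "t - s = (t - real m * T) + real n * T + (real l * T - s)"
      by (simp add: mn algebra_simps)
    moreover have "impulse_count (periodic_sequence T) t s = Suc n"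
      by (rule window(1))
    ultimately show ?thesis by blast
  qed
qed

lemma propagator_periodic_power:
  assumes "T > 0" and "C0_semigroup S"
  shows "impulse_count (periodic_sequence T) (real n * T) 0 = n"
    and "blinfun_apply (propagator S J (periodic_sequence T) (real n * T) 0) x
      = (blinfun_apply (J o\<^sub>L S T) ^^ n) x"
proof -
  have "impulse_count (periodic_sequence T) (real n * T) 0 = n \<and>
    blinfun_apply (propagator S J (periodic_sequence T) (real n * T) 0) x
      = (blinfun_apply (J o\<^sub>L S T) ^^ n) x"
  proof (cases n)
    case 0
    then show ?thesis
      using assms by (simp add: impulse_count_def propagator_def C0_semigroup_0)
  next
    case (Suc k)
    have window: "impulse_times (periodic_sequence T) \<inter> {0<..real n * T} = (\<lambda>k. real k * T) ` {1..1 + k}"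
      using \<open>T > 0\<close> by (auto simp: impulse_times_def periodic_sequence_def Suc)
    show ?thesis
      using propagator_of_window(1)[OF \<open>T > 0\<close> window]
        propagator_of_window(2)[OF \<open>T > 0\<close> window, of S J x] assms
      by (simp add: Suc C0_semigroup_0 funpow_Suc_right del: funpow.simps)
  qed
  then show "impulse_count (periodic_sequence T) (real n * T) 0 = n"
    and "blinfun_apply (propagator S J (periodic_sequence T) (real n * T) 0) x
      = (blinfun_apply (J o\<^sub>L S T) ^^ n) x" by auto
qed

text \<open>Before the first impulse the propagator is the semigroup itself, so the growth condition bounds
  \<open>S\<close> on \<open>[0, T)\<close>. The endpoint is reached through \<open>S(T) = S(T/2) S(T/2)\<close>.\<close>

lemma growth_condition_semigroup_bound:
  fixes S :: "real \<Rightarrow> 'a::banach \<Rightarrow>\<^sub>L 'a"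
  assumes S: "C0_semigroup S" and "T > 0" and "growth_condition S J T"
  obtains K where "K \<ge> 1" "\<And>t x. t \<in> {0..T} \<Longrightarrow> norm (blinfun_apply (S t) x) \<le> K * norm x"
proof -
  obtain g :: "real \<Rightarrow> real" and \<mu> :: real
    where growth: "\<And>s t x. s \<ge> 0 \<Longrightarrow> t \<ge> s \<Longrightarrow>
        norm (blinfun_apply (propagator S J (periodic_sequence T) t s) x)
          \<le> g (t - s) * \<mu> ^ impulse_count (periodic_sequence T) t s * norm x"
      and bdd: "bdd_above (g ` {0..<T})"
    using assms(3) unfolding growth_condition_def by metis
  obtain G where G: "\<And>t. t \<in> {0..<T} \<Longrightarrow> g t \<le> G"
    using bdd unfolding bdd_above_def by (metis imageI)
  define K where "K = max 1 G"
  have "K \<ge> 1" by (simp add: K_def)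
  have K: "norm (blinfun_apply (S t) x) \<le> K * norm x" if t: "t \<in> {0..<T}" for t x
  proof -
    obtain l where "l \<ge> 1" "0 < real l * T" "real l * T \<le> 0 + T"
      and I: "impulse_times (periodic_sequence T) \<inter> {0<..t}
        = (\<lambda>k. real k * T) ` {k. l \<le> k \<and> real k * T \<le> t}"
      by (rule impulse_window[OF \<open>T > 0\<close> order_refl])
    have "real k * T > t" if "l \<le> k" for k
    proof -
      have "1 * T \<le> real k * T" using that \<open>l \<ge> 1\<close> \<open>T > 0\<close> by (intro mult_right_mono) auto
      then show ?thesis using t unfolding atLeastLessThan_iff by linarith
    qed
    then have "impulse_times (periodic_sequence T) \<inter> {0<..t} = {}"
      unfolding I using not_le by blast
    then have "norm (blinfun_apply (S t) x) \<le> g t * norm x"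
      using growth[of 0 t x] t by (simp add: propagator_def impulse_count_def)
    also have "\<dots> \<le> K * norm x" using G[OF t] by (intro mult_right_mono) (auto simp: K_def)
    finally show ?thesis .
  qed
  have KT: "norm (blinfun_apply (S T) x) \<le> K * (K * norm x)" for x
  proof -
    have "norm (blinfun_apply (S T) x)
        = norm (blinfun_apply (S (T / 2)) (blinfun_apply (S (T / 2)) x))"
      using C0_semigroup_add[OF S, of "T / 2" "T / 2" x] \<open>T > 0\<close> by simp
    also have "\<dots> \<le> K * norm (blinfun_apply (S (T / 2)) x)"
      using \<open>T > 0\<close> by (intro K) auto
    also have "\<dots> \<le> K * (K * norm x)"
      using K[of "T / 2" x] \<open>T > 0\<close> \<open>K \<ge> 1\<close> by (intro mult_left_mono) auto
    finally show ?thesis .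
  qed
  show thesis
  proof
    show "K * K \<ge> 1" using \<open>K \<ge> 1\<close> mult_mono[of 1 K 1 K] by simp
    fix t x assume t: "t \<in> {0..T}"
    show "norm (blinfun_apply (S t) x) \<le> K * K * norm x"
    proof (cases "t = T")
      case True
      then show ?thesis using KT by (simp add: mult.assoc)
    next
      case False
      then have "norm (blinfun_apply (S t) x) \<le> K * norm x" using t by (intro K) auto
      also have "\<dots> \<le> K * (K * norm x)"
        using \<open>K \<ge> 1\<close> mult_right_mono[of 1 K "norm x"] by (intro mult_left_mono) auto
      finally show ?thesis by (simp add: mult.assoc)
    qed
  qed
qed

section \<open>Geometric decay of the monodromy\<close>

definition geometrically_decaying :: "('a::real_normed_vector \<Rightarrow> 'a) \<Rightarrow> bool" where
  "geometrically_decaying M \<longleftrightarrow>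
     (\<exists>C q. C \<ge> 1 \<and> 0 < q \<and> q < 1 \<and> (\<forall>n x. norm ((M ^^ n) x) \<le> C * q ^ n * norm x))"

text \<open>The powers of the monodromy are themselves propagators, over \<open>[0, n T]\<close>. Conversely the powers
  control every propagator up to the two incomplete periods at the ends of the interval.\<close>

lemma strongly_UGES_iff_monodromy:
  fixes S :: "real \<Rightarrow> 'a::banach \<Rightarrow>\<^sub>L 'a"
  assumes S: "C0_semigroup S" and "T > 0" and "growth_condition S J T"
  shows "strongly_UGES S J (constant_dwell_sequences T) \<longleftrightarrow>
    geometrically_decaying (blinfun_apply (J o\<^sub>L S T))"
proof
  assume "strongly_UGES S J (constant_dwell_sequences T)"
  then obtain M \<alpha> \<rho> where *: "M \<ge> 1" "\<alpha> > 0" "0 < \<rho>" "\<rho> < 1"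
    and U: "\<And>s t. s \<ge> 0 \<Longrightarrow> t \<ge> s \<Longrightarrow> norm (propagator S J (periodic_sequence T) t s)
      \<le> M * \<rho> ^ impulse_count (periodic_sequence T) t s * exp (- \<alpha> * (t - s))"
    unfolding strongly_UGES_def constant_dwell_sequences_eq[OF \<open>T > 0\<close>] by auto
  have "norm ((blinfun_apply (J o\<^sub>L S T) ^^ n) x) \<le> M * \<rho> ^ n * norm x" for n x
  proof -
    let ?P = "propagator S J (periodic_sequence T) (real n * T) 0"
    have "norm ?P \<le> M * \<rho> ^ n * exp (- \<alpha> * (real n * T - 0))"
      using U[of 0 "real n * T"] \<open>T > 0\<close> propagator_periodic_power(1)[OF \<open>T > 0\<close> S, of n] by simp
    also have "\<dots> \<le> M * \<rho> ^ n * 1"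
      using * \<open>T > 0\<close> by (intro mult_left_mono) auto
    finally have "norm ?P * norm x \<le> M * \<rho> ^ n * norm x" by (intro mult_right_mono) auto
    then show ?thesis
      using norm_blinfun[of ?P x] propagator_periodic_power(2)[OF \<open>T > 0\<close> S, of J n x] by simp
  qed
  with * show "geometrically_decaying (blinfun_apply (J o\<^sub>L S T))"
    unfolding geometrically_decaying_def by blast
next
  assume "geometrically_decaying (blinfun_apply (J o\<^sub>L S T))"
  then obtain C q where *: "C \<ge> 1" "0 < q" "q < 1"
    and decay: "\<And>n x. norm ((blinfun_apply (J o\<^sub>L S T) ^^ n) x) \<le> C * q ^ n * norm x"
    unfolding geometrically_decaying_def by auto
  obtain K where "K \<ge> 1" and K: "\<And>t x. t \<in> {0..T} \<Longrightarrow> norm (blinfun_apply (S t) x) \<le> K * norm x"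
    using growth_condition_semigroup_bound[OF assms] by metis
  \<comment> \<open>Half of the decay \<open>q = r\<^sup>2\<close> per impulse is kept, the other half becomes decay in time.\<close>
  define r where "r = sqrt q"
  have r: "0 < r" "r < 1" "q = r * r" using * by (auto simp: r_def)
  define \<alpha> where "\<alpha> = - ln r / T"
  have "\<alpha> > 0" using r \<open>T > 0\<close> by (simp add: \<alpha>_def divide_neg_pos)
  have exp_lower: "r ^ k \<le> exp (- \<alpha> * d)" if "d \<le> real k * T" for k d
  proof -
    have "r ^ k = exp (- \<alpha> * (real k * T))"
      using r \<open>T > 0\<close> powr_realpow[of r k] by (simp add: \<alpha>_def powr_def mult.commute)
    then show ?thesis using that \<open>\<alpha> > 0\<close> by simp
  qed
  define B where "B = K * C * (norm J + 1) * K"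
  have "K * C \<ge> 1" using \<open>K \<ge> 1\<close> \<open>C \<ge> 1\<close> mult_mono[of 1 K 1 C] by simp
  then have "K * C * (norm J + 1) \<ge> 1" using mult_mono[of 1 "K * C" 1 "norm J + 1"] by simp
  then have "B \<ge> K" using \<open>K \<ge> 1\<close> mult_right_mono[of 1 "K * C * (norm J + 1)" K] unfolding B_def by linarith
  \<comment> \<open>With \<open>n + 1\<close> impulses the available decay is \<open>q\<^sup>n = r\<^sup>2\<^sup>n\<close>, while \<open>r\<^sup>n\<^sup>+\<^sup>1\<close> is spent on the
    impulses and \<open>r\<^sup>n\<^sup>+\<^sup>2\<close> on the elapsed time; the deficit \<open>r\<^sup>3\<close> goes into the constant.\<close>
  define M where "M = B / r ^ 3"
  have "r ^ 3 \<le> 1" "r ^ 3 > 0" using r by (auto simp: power_le_one)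
  then have "B \<le> M" using \<open>B \<ge> K\<close> \<open>K \<ge> 1\<close> mult_left_mono[of "r ^ 3" 1 B]
    by (simp add: M_def pos_le_divide_eq)
  have MB: "M * r ^ 3 = B" using r by (simp add: M_def)
  have "norm (propagator S J (periodic_sequence T) t s)
      \<le> M * r ^ impulse_count (periodic_sequence T) t s * exp (- \<alpha> * (t - s))"
    if "s \<ge> 0" "t \<ge> s" for s t
    using propagator_periodic[OF \<open>T > 0\<close> that, of S J]
  proof (elim disjE exE conjE)
    assume c: "impulse_count (periodic_sequence T) t s = 0" "t - s < T"
      and P: "propagator S J (periodic_sequence T) t s = S (t - s)"
    have "norm (S (t - s)) \<le> K"
      using K[of "t - s"] c \<open>K \<ge> 1\<close> that by (intro norm_blinfun_bound) auto
    also have "\<dots> \<le> M * r ^ 3" using MB \<open>B \<ge> K\<close> by simp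
    also have "\<dots> \<le> M * r ^ 1"
      using r \<open>B \<le> M\<close> \<open>B \<ge> K\<close> \<open>K \<ge> 1\<close> by (intro mult_left_mono power_decreasing) auto
    also have "\<dots> \<le> M * exp (- \<alpha> * (t - s))"
      using exp_lower[of "t - s" 1] c \<open>B \<le> M\<close> \<open>B \<ge> K\<close> \<open>K \<ge> 1\<close> by (intro mult_left_mono) auto
    finally show ?thesis using c P by simp
  next
    fix n a b
    assume c: "impulse_count (periodic_sequence T) t s = Suc n"
      and ab: "a \<in> {0..T}" "b \<in> {0..T}" and ts: "t - s = a + real n * T + b"
      and P: "\<forall>x. blinfun_apply (propagator S J (periodic_sequence T) t s) x
        = blinfun_apply (S a) ((blinfun_apply (J o\<^sub>L S T) ^^ n) (blinfun_apply J (blinfun_apply (S b) x)))"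
    have "norm (propagator S J (periodic_sequence T) t s) \<le> B * q ^ n"
    proof (rule norm_blinfun_bound)
      show "0 \<le> B * q ^ n" using * \<open>B \<ge> K\<close> \<open>K \<ge> 1\<close> by simp
      fix x
      have "norm (blinfun_apply (propagator S J (periodic_sequence T) t s) x)
          \<le> K * (C * q ^ n * ((norm J + 1) * (K * norm x)))"
      proof -
        have "norm (blinfun_apply J (blinfun_apply (S b) x)) \<le> norm J * norm (blinfun_apply (S b) x)"
          by (rule norm_blinfun)
        also have "\<dots> \<le> (norm J + 1) * (K * norm x)"
          using K[OF ab(2)] by (intro mult_mono) auto
        finally have J: "norm (blinfun_apply J (blinfun_apply (S b) x)) \<le> (norm J + 1) * (K * norm x)" .
        have "norm ((blinfun_apply (J o\<^sub>L S T) ^^ n) (blinfun_apply J (blinfun_apply (S b) x)))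
            \<le> C * q ^ n * norm (blinfun_apply J (blinfun_apply (S b) x))"
          by (rule decay)
        also have "\<dots> \<le> C * q ^ n * ((norm J + 1) * (K * norm x))"
          using J * by (intro mult_left_mono) auto
        finally have "K * norm ((blinfun_apply (J o\<^sub>L S T) ^^ n) (blinfun_apply J (blinfun_apply (S b) x)))
            \<le> K * (C * q ^ n * ((norm J + 1) * (K * norm x)))"
          using \<open>K \<ge> 1\<close> by (intro mult_left_mono) auto
        with K[OF ab(1)] show ?thesis unfolding P[rule_format] by (rule order_trans)
      qed
      then show "norm (blinfun_apply (propagator S J (periodic_sequence T) t s) x) \<le> B * q ^ n * norm x"
        by (simp add: B_def mult_ac)
    qed
    also have "\<dots> = M * r ^ Suc n * r ^ (n + 2)"
      unfolding MB[symmetric] r(3)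
      by (simp add: power_mult_distrib power_add power2_eq_square power3_eq_cube)
    also have "\<dots> \<le> M * r ^ Suc n * exp (- \<alpha> * (t - s))"
      using ab r \<open>B \<le> M\<close> \<open>B \<ge> K\<close> \<open>K \<ge> 1\<close>
      by (intro mult_left_mono exp_lower) (auto simp: ts algebra_simps)
    finally show ?thesis unfolding c .
  qed
  moreover have "M \<ge> 1" using \<open>B \<le> M\<close> \<open>B \<ge> K\<close> \<open>K \<ge> 1\<close> by simp
  ultimately show "strongly_UGES S J (constant_dwell_sequences T)"
    unfolding strongly_UGES_def constant_dwell_sequences_eq[OF \<open>T > 0\<close>]
    using r \<open>\<alpha> > 0\<close> by (intro exI[of _ M] exI[of _ \<alpha>] exI[of _ r]) auto
qed

section \<open>Lyapunov functions of the monodromy\<close>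

text \<open>Taking \<open>p\<close>-th roots of the iterated inequality replaces the rate \<open>\<mu>\<close> by
  \<open>\<mu>\<^bsup>1/p\<^esup>\<close>, which is still below \<open>1\<close>.\<close>

lemma geometrically_decaying_if_Lyapunov:
  assumes "p \<ge> 1" "c \<ge> 1" "0 < \<mu>" "\<mu> < 1"
    and lower: "\<And>x. norm x powr p \<le> V x" and upper: "\<And>x. V x \<le> c * norm x powr p"
    and step: "\<And>x. V (M x) \<le> \<mu> * V x"
  shows "geometrically_decaying M"
proof -
  have iter: "V ((M ^^ n) x) \<le> \<mu> ^ n * V x" for n x
  proof (induction n)
    case (Suc n)
    have "V ((M ^^ Suc n) x) \<le> \<mu> * V ((M ^^ n) x)" using step by simp
    also have "\<dots> \<le> \<mu> * (\<mu> ^ n * V x)" using Suc assms by (intro mult_left_mono) auto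
    finally show ?case by simp
  qed simp
  have "norm ((M ^^ n) x) \<le> c powr (1 / p) * (\<mu> powr (1 / p)) ^ n * norm x" for n x
  proof -
    have "norm ((M ^^ n) x) powr p \<le> \<mu> ^ n * (c * norm x powr p)"
      using lower[of "(M ^^ n) x"] iter[of n x] mult_left_mono[OF upper[of x], of "\<mu> ^ n"]
        zero_le_power[of \<mu> n] \<open>0 < \<mu>\<close> by linarith
    then have "(norm ((M ^^ n) x) powr p) powr (1 / p) \<le> (\<mu> ^ n * (c * norm x powr p)) powr (1 / p)"
      using assms by (intro powr_mono2) auto
    then show ?thesis
      using assms by (simp add: powr_powr powr_mult powr_power mult_ac powr_realpow[symmetric])
  qed
  moreover have "c powr (1 / p) \<ge> 1" using assms by (intro ge_one_powr_ge_zero) auto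
  moreover have "\<mu> powr (1 / p) < 1" using assms powr_less_mono2[of "1 / p" \<mu> 1] by simp
  ultimately show ?thesis
    unfolding geometrically_decaying_def using assms by (metis powr_gt_zero less_irrefl)
qed

lemma Lyapunov_if_geometrically_decaying:
  fixes M :: "'a::banach \<Rightarrow> 'a"
  assumes "linear M" and "geometrically_decaying M"
  obtains c \<mu> V where "c \<ge> 1" "0 < \<mu>" "\<mu> < 1" "\<And>x. norm x \<le> V x" "\<And>x. V x \<le> c * norm x"
    "\<And>x. V (M x) \<le> \<mu> * V x" "\<And>x y. V x \<le> V y + V (x - y)"
proof -
  obtain C q where C: "C \<ge> 1" and q: "0 < q" "q < 1"
    and decay: "\<And>n x. norm ((M ^^ n) x) \<le> C * q ^ n * norm x"
    using assms(2) unfolding geometrically_decaying_def by auto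
  show thesis
    by (rule contracting_renorming[OF assms(1) q(1) decay]) (rule that[OF C q])
qed

section \<open>Time-dependent Lyapunov functionals\<close>

text \<open>Integrating the Dini inequality over one period and then applying the jump inequality shows
  that \<open>V(0, \<cdot>)\<close> is a Lyapunov function of the monodromy. Uniformity of the Lipschitz
  constants in \<open>\<tau>\<close> makes \<open>V\<close> continuous along trajectories.\<close>

lemma monodromy_decrease:
  fixes S :: "real \<Rightarrow> 'a::banach \<Rightarrow>\<^sub>L 'a"
  assumes S: "C0_semigroup S" and "T > 0"
    and K: "\<And>t x. t \<in> {0..T} \<Longrightarrow> norm (blinfun_apply (S t) x) \<le> K * norm x"
    and lip: "uniformly_lipschitz_on_bounded {0..T} V"
    and cont: "\<And>x. continuous_on {0..T} (\<lambda>\<tau>. V \<tau> x)"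
    and Dini: "\<And>\<tau> x. \<tau> \<in> {0..<T} \<Longrightarrow> lower_right_Dini S V \<tau> x \<le> ereal (- \<eta> * V \<tau> x)"
    and jump: "\<And>x. V 0 (blinfun_apply J x) \<le> \<mu> * V T x" and "\<mu> > 0"
  shows "V 0 (blinfun_apply (J o\<^sub>L S T) x) \<le> \<mu> * exp (- \<eta> * T) * V 0 x"
proof -
  define \<phi> where "\<phi> t = V t (blinfun_apply (S t) x)" for t
  have "K * norm x \<ge> 0" using \<open>T > 0\<close> by (intro order_trans[OF norm_ge_zero K[of 0 x]]) auto
  then have "K * norm x + 1 > 0" by simp
  then obtain L where "L > 0" and L: "\<And>\<tau>. \<tau> \<in> {0..T} \<Longrightarrow> L-lipschitz_on (ball 0 (K * norm x + 1)) (V \<tau>)"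
    using lip unfolding uniformly_lipschitz_on_bounded_def by metis
  have S_cont: "continuous_on {0..T} (\<lambda>t. blinfun_apply (S t) x)"
    using C0_semigroup_continuous_on[OF S K] by blast
  have "continuous_on {0..T} \<phi>"
    unfolding continuous_on_def
  proof
    fix t assume t: "t \<in> {0..T}"
    let ?F = "at t within {0..T}"
    have "((\<lambda>r. L * norm (blinfun_apply (S r) x - blinfun_apply (S t) x)
          + norm (V r (blinfun_apply (S t) x) - V t (blinfun_apply (S t) x)))
        \<longlongrightarrow> L * norm (blinfun_apply (S t) x - blinfun_apply (S t) x)
          + norm (V t (blinfun_apply (S t) x) - V t (blinfun_apply (S t) x))) ?F"
      by (intro tendsto_add tendsto_mult tendsto_norm tendsto_diff tendsto_const)
        (use S_cont cont t in \<open>auto simp: continuous_on_def\<close>)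
    then have lim: "((\<lambda>r. L * norm (blinfun_apply (S r) x - blinfun_apply (S t) x)
          + norm (V r (blinfun_apply (S t) x) - V t (blinfun_apply (S t) x))) \<longlongrightarrow> 0) ?F"
      by simp
    have "norm (\<phi> r - \<phi> t) \<le> L * norm (blinfun_apply (S r) x - blinfun_apply (S t) x)
          + norm (V r (blinfun_apply (S t) x) - V t (blinfun_apply (S t) x))"
      if r: "r \<in> {0..T}" for r
    proof -
      have "dist (V r (blinfun_apply (S r) x)) (V r (blinfun_apply (S t) x))
          \<le> L * dist (blinfun_apply (S r) x) (blinfun_apply (S t) x)"
        using K[OF r, of x] K[OF t, of x] by (intro lipschitz_onD[OF L[OF r]]) auto
      then show ?thesis unfolding \<phi>_def dist_norm real_norm_def by linarith
    qed
    then have "eventually (\<lambda>r. norm (\<phi> r - \<phi> t) \<le> L * norm (blinfun_apply (S r) x - blinfun_apply (S t) x)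
          + norm (V r (blinfun_apply (S t) x) - V t (blinfun_apply (S t) x))) ?F"
      by (simp add: eventually_at_filter)
    then have "((\<lambda>r. \<phi> r - \<phi> t) \<longlongrightarrow> 0) ?F"
      using lim by (rule Lim_null_comparison)
    then show "(\<phi> \<longlongrightarrow> \<phi> t) ?F" by (rule LIM_zero_cancel)
  qed
  moreover have "Liminf (at_right 0) (\<lambda>h. ereal ((\<phi> (t + h) - \<phi> t) / h)) \<le> ereal (- \<eta> * \<phi> t)"
    if t: "t \<in> {0..<T}" for t
  proof -
    have "eventually (\<lambda>h. ereal ((\<phi> (t + h) - \<phi> t) / h)
        = ereal ((V (t + h) (blinfun_apply (S h) (blinfun_apply (S t) x)) - V t (blinfun_apply (S t) x)) / h))
        (at_right 0)"
      using t C0_semigroup_add[OF S, of _ t x]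
      by (auto simp: eventually_at_filter \<phi>_def add.commute)
    then have "Liminf (at_right 0) (\<lambda>h. ereal ((\<phi> (t + h) - \<phi> t) / h))
        = lower_right_Dini S V t (blinfun_apply (S t) x)"
      unfolding lower_right_Dini_def by (rule Liminf_eq)
    with Dini[OF t] show ?thesis by (simp add: \<phi>_def)
  qed
  ultimately have "\<phi> T \<le> \<phi> 0 * exp (- \<eta> * T)"
    using \<open>T > 0\<close> by (intro exponential_decay_lower_Dini) auto
  then have "\<mu> * \<phi> T \<le> \<mu> * (\<phi> 0 * exp (- \<eta> * T))" using \<open>\<mu> > 0\<close> by simp
  with jump[of "blinfun_apply (S T) x"] show ?thesis
    using S by (simp add: \<phi>_def C0_semigroup_0 mult_ac)
qed

text \<open>The converse construction: a coercive part that does not grow along the flow, plus a large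
  multiple of the discrete Lyapunov norm of the state just after the next impulse.\<close>

lemma time_dependent_Lyapunov:
  fixes S :: "real \<Rightarrow> 'a::banach \<Rightarrow>\<^sub>L 'a"
  assumes S: "C0_semigroup S" and "T > 0" and "K \<ge> 1"
    and K: "\<And>t x. t \<in> {0..T} \<Longrightarrow> norm (blinfun_apply (S t) x) \<le> K * norm x"
    and decay: "geometrically_decaying (blinfun_apply (J o\<^sub>L S T))"
  obtains c \<mu> V where "c \<ge> 1" "0 < \<mu>" "\<mu> < 1" "uniformly_lipschitz_on_bounded {0..T} V"
    "\<And>x. continuous_on {0..T} (\<lambda>\<tau>. V \<tau> x)"
    "\<And>\<tau> x. \<tau> \<in> {0..T} \<Longrightarrow> norm x \<le> V \<tau> x" "\<And>\<tau> x. \<tau> \<in> {0..T} \<Longrightarrow> V \<tau> x \<le> c * norm x"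
    "\<And>\<tau> x. \<tau> \<in> {0..<T} \<Longrightarrow> lower_right_Dini S V \<tau> x \<le> 0"
    "\<And>x. V 0 (blinfun_apply J x) \<le> \<mu> * V T x"
proof -
  have "linear (blinfun_apply (J o\<^sub>L S T))"
    by (intro bounded_linear.linear blinfun.bounded_linear_right)
  then obtain C q W where "C \<ge> 1" and q: "0 < q" "q < 1"
    and W: "\<And>x. norm x \<le> W x" "\<And>x. W x \<le> C * norm x"
      "\<And>x. W (blinfun_apply (J o\<^sub>L S T) x) \<le> q * W x" "\<And>x y. W x \<le> W y + W (x - y)"
    using Lyapunov_if_geometrically_decaying[OF _ decay] by metis
  obtain N :: "'a \<Rightarrow> real" and \<omega> where "\<omega> \<ge> 0"
    and N: "\<And>x. norm x \<le> N x" "\<And>x. N x \<le> K * norm x"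
      "\<And>h x. h \<in> {0..T} \<Longrightarrow> N (blinfun_apply (S h) x) \<le> exp (\<omega> * h) * N x"
      "\<And>x y. N x \<le> N y + N (x - y)"
    using semigroup_renorming[OF S \<open>T > 0\<close> \<open>K \<ge> 1\<close> K] by metis
  have N0: "N x \<ge> 0" and W0: "W x \<ge> 0" for x
    using N(1)[of x] W(1)[of x] norm_ge_zero[of x] by linarith+
  define E where "E = exp (\<omega> * T)"
  have "E \<ge> 1" using \<open>\<omega> \<ge> 0\<close> \<open>T > 0\<close> by (simp add: E_def)
  define \<mu> where "\<mu> = (1 + q) / 2"
  \<comment> \<open>The solution of \<open>E K + \<beta> q = \<mu> \<beta>\<close>: the coercive part after a jump, at most \<open>E K W\<close>, is
    covered by the gap between \<open>q\<close> and \<open>\<mu>\<close>.\<close>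
  define \<beta> where "\<beta> = 2 * E * K / (1 - q)"
  have "\<beta> > 0" using \<open>E \<ge> 1\<close> \<open>K \<ge> 1\<close> q by (simp add: \<beta>_def)
  have \<beta>: "E * K + \<beta> * q = \<mu> * \<beta>"
    using q by (simp add: \<beta>_def \<mu>_def divide_simps) (simp add: algebra_simps)
  define V where "V \<tau> x = exp (\<omega> * (T - \<tau>)) * N x + \<beta> * W (blinfun_apply J (blinfun_apply (S (T - \<tau>)) x))"
    for \<tau> x
  define c where "c = E * K + \<beta> * (C * (norm J * K))"
  have exp_bounds: "1 \<le> exp (\<omega> * (T - \<tau>))" "exp (\<omega> * (T - \<tau>)) \<le> E" if "\<tau> \<in> {0..T}" for \<tau>
    using that \<open>\<omega> \<ge> 0\<close> by (auto simp: E_def mult_left_mono)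
  have lower: "norm x \<le> V \<tau> x" if "\<tau> \<in> {0..T}" for \<tau> x
  proof -
    have "1 * N x \<le> exp (\<omega> * (T - \<tau>)) * N x"
      using exp_bounds[OF that] N0 by (intro mult_right_mono) auto
    moreover have "0 \<le> \<beta> * W (blinfun_apply J (blinfun_apply (S (T - \<tau>)) x))"
      using \<open>\<beta> > 0\<close> W0 by simp
    ultimately show ?thesis using N(1)[of x] unfolding V_def by linarith
  qed
  have upper: "V \<tau> x \<le> c * norm x" if "\<tau> \<in> {0..T}" for \<tau> x
  proof -
    have "exp (\<omega> * (T - \<tau>)) * N x \<le> E * (K * norm x)"
      using exp_bounds[OF that] N(2) N0 \<open>E \<ge> 1\<close> by (intro mult_mono) auto
    moreover have "W (blinfun_apply J (blinfun_apply (S (T - \<tau>)) x)) \<le> C * (norm J * (K * norm x))"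
    proof -
      have "norm (blinfun_apply J (blinfun_apply (S (T - \<tau>)) x)) \<le> norm J * norm (blinfun_apply (S (T - \<tau>)) x)"
        by (rule norm_blinfun)
      also have "\<dots> \<le> norm J * (K * norm x)" using K that by (intro mult_left_mono) auto
      finally have "C * norm (blinfun_apply J (blinfun_apply (S (T - \<tau>)) x)) \<le> C * (norm J * (K * norm x))"
        using \<open>C \<ge> 1\<close> by (intro mult_left_mono) auto
      with W(2) show ?thesis by (rule order_trans)
    qed
    ultimately have "V \<tau> x \<le> E * (K * norm x) + \<beta> * (C * (norm J * (K * norm x)))"
      unfolding V_def using \<open>\<beta> > 0\<close> by (intro add_mono mult_left_mono) auto
    then show ?thesis by (simp add: c_def algebra_simps)
  qed
  have "E * K \<ge> 1" using \<open>E \<ge> 1\<close> \<open>K \<ge> 1\<close> mult_mono[of 1 E 1 K] by simp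
  moreover have "\<beta> * (C * (norm J * K)) \<ge> 0" using \<open>\<beta> > 0\<close> \<open>C \<ge> 1\<close> \<open>K \<ge> 1\<close> by simp
  ultimately have "c \<ge> 1" unfolding c_def by linarith
  have sub: "V \<tau> x \<le> V \<tau> y + V \<tau> (x - y)" for \<tau> x y
  proof -
    have "exp (\<omega> * (T - \<tau>)) * N x \<le> exp (\<omega> * (T - \<tau>)) * (N y + N (x - y))"
      using N(4)[of x y] by simp
    moreover have "\<beta> * W (blinfun_apply J (blinfun_apply (S (T - \<tau>)) x))
        \<le> \<beta> * (W (blinfun_apply J (blinfun_apply (S (T - \<tau>)) y))
          + W (blinfun_apply J (blinfun_apply (S (T - \<tau>)) (x - y))))"
      using W(4)[of "blinfun_apply J (blinfun_apply (S (T - \<tau>)) x)"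
          "blinfun_apply J (blinfun_apply (S (T - \<tau>)) y)"] \<open>\<beta> > 0\<close>
      by (simp add: blinfun.diff_right)
    ultimately show ?thesis unfolding V_def distrib_left by linarith
  qed
  have "c-lipschitz_on X (V \<tau>)" if "\<tau> \<in> {0..T}" for X \<tau>
    using sub upper[OF that] \<open>c \<ge> 1\<close> by (intro lipschitz_if_subadditive) auto
  then have lip: "uniformly_lipschitz_on_bounded {0..T} V"
    unfolding uniformly_lipschitz_on_bounded_def using \<open>c \<ge> 1\<close> by (intro allI impI exI[of _ c]) auto
  have cont: "continuous_on {0..T} (\<lambda>\<tau>. V \<tau> x)" for x
  proof -
    have "C-lipschitz_on UNIV W"
      using W \<open>C \<ge> 1\<close> by (intro lipschitz_if_subadditive) auto
    then have "continuous_on UNIV W" by (rule lipschitz_on_continuous_on)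
    moreover have "continuous_on {0..T} (\<lambda>\<tau>. blinfun_apply (S (T - \<tau>)) x)"
      by (rule continuous_on_compose2[OF C0_semigroup_continuous_on[OF S K, of T]])
        (auto intro!: continuous_intros)
    then have "continuous_on {0..T} (\<lambda>\<tau>. blinfun_apply J (blinfun_apply (S (T - \<tau>)) x))"
      by (rule bounded_linear.continuous_on[OF blinfun.bounded_linear_right])
    ultimately have "continuous_on {0..T} (\<lambda>\<tau>. W (blinfun_apply J (blinfun_apply (S (T - \<tau>)) x)))"
      by (rule continuous_on_compose2) auto
    then show ?thesis unfolding V_def by (intro continuous_intros)
  qed
  have Dini: "lower_right_Dini S V \<tau> x \<le> 0" if \<tau>: "\<tau> \<in> {0..<T}" for \<tau> x
  proof -
    have "eventually (\<lambda>h. h \<in> {0<..<T - \<tau>}) (at_right 0)"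
      using \<tau> by (intro eventually_at_right_real) simp
    then have "eventually (\<lambda>h. ereal ((V (\<tau> + h) (blinfun_apply (S h) x) - V \<tau> x) / h) \<le> 0) (at_right 0)"
    proof eventually_elim
      case (elim h)
      have flow: "blinfun_apply (S (T - (\<tau> + h))) (blinfun_apply (S h) x) = blinfun_apply (S (T - \<tau>)) x"
        using C0_semigroup_add[OF S, of "T - (\<tau> + h)" h x] elim by simp
      have "exp (\<omega> * (T - (\<tau> + h))) * N (blinfun_apply (S h) x)
          \<le> exp (\<omega> * (T - (\<tau> + h))) * (exp (\<omega> * h) * N x)"
        using N(3)[of h x] elim \<tau> by (intro mult_left_mono) auto
      also have "\<dots> = exp (\<omega> * (T - \<tau>)) * N x"
        by (simp add: mult.assoc[symmetric] mult_exp_exp algebra_simps)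
      finally have "V (\<tau> + h) (blinfun_apply (S h) x) \<le> V \<tau> x"
        unfolding V_def flow by simp
      then show ?case using elim by (auto simp: divide_nonpos_pos)
    qed
    then have "lower_right_Dini S V \<tau> x \<le> Liminf (at_right 0) (\<lambda>h::real. 0)"
      unfolding lower_right_Dini_def by (rule Liminf_mono)
    then show ?thesis by (simp add: Liminf_const)
  qed
  have jump: "V 0 (blinfun_apply J x) \<le> \<mu> * V T x" for x
  proof -
    let ?y = "blinfun_apply J x"
    have "V 0 ?y = E * N ?y + \<beta> * W (blinfun_apply (J o\<^sub>L S T) ?y)"
      by (simp add: V_def E_def)
    also have "\<dots> \<le> E * (K * W ?y) + \<beta> * (q * W ?y)"
    proof (intro add_mono mult_left_mono)
      show "N ?y \<le> K * W ?y"
        using \<open>K \<ge> 1\<close> by (intro order_trans[OF N(2)[of ?y]] mult_left_mono[OF W(1)[of ?y]]) auto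
    qed (use W(3)[of ?y] \<open>\<beta> > 0\<close> \<open>E \<ge> 1\<close> in auto)
    also have "\<dots> = (E * K + \<beta> * q) * W ?y" by (simp add: algebra_simps)
    also have "\<dots> = \<mu> * (\<beta> * W ?y)" by (simp add: \<beta>)
    also have "\<dots> \<le> \<mu> * V T x"
      using N0[of x] q S by (intro mult_left_mono) (auto simp: V_def \<mu>_def C0_semigroup_0)
    finally show ?thesis .
  qed
  show thesis
    by (rule that[of c \<mu> V]) (use \<open>c \<ge> 1\<close> q lip cont lower upper Dini jump in \<open>auto simp: \<mu>_def\<close>)
qed

section \<open>The equivalence\<close>

theorem theorem5p3:
  fixes S :: "real \<Rightarrow> 'a::banach \<Rightarrow>\<^sub>L 'a"
    and A :: "'a \<Rightarrow> 'a" and D :: "'a set"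
    and J :: "'a \<Rightarrow>\<^sub>L 'a" and T :: real
  assumes "generates A D S"
    and "J \<noteq> 0"
    and "blinfun_apply J ` D \<subseteq> D"
    and "T > 0"
    and "growth_condition S J T"
  shows
    "(strongly_UGES S J (constant_dwell_sequences T) \<longleftrightarrow>
        (\<exists>(p::real) (c::real) (\<eta>::real) (\<mu>::real) (V :: real \<Rightarrow> 'a \<Rightarrow> real).
           p \<ge> 1 \<and> c \<ge> 1 \<and> \<eta> \<ge> 0 \<and> 0 < \<mu> \<and> \<mu> \<le> 1 \<and> \<eta> + (- ln \<mu>) > 0 \<and>
           (\<forall>\<tau>\<in>{0..T}. \<forall>x. 0 \<le> V \<tau> x) \<and>
           uniformly_lipschitz_on_bounded {0..T} V \<and>
           (\<forall>x. continuous_on {0..T} (\<lambda>\<tau>. V \<tau> x)) \<and>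
           (\<forall>x. (\<forall>\<tau>\<in>{0..T}. norm x powr p \<le> V \<tau> x \<and> V \<tau> x \<le> c * norm x powr p) \<and>
                (\<forall>\<tau>\<in>{0..<T}. lower_right_Dini S V \<tau> x \<le> ereal (- \<eta> * V \<tau> x)) \<and>
                V 0 (blinfun_apply J x) \<le> \<mu> * V T x)))
     \<and>
     (strongly_UGES S J (constant_dwell_sequences T) \<longleftrightarrow>
        (\<exists>(p::real) (c::real) (\<mu>::real) (V :: 'a \<Rightarrow> real).
           p \<ge> 1 \<and> c \<ge> 1 \<and> 0 < \<mu> \<and> \<mu> < 1 \<and>
           (\<forall>x. 0 \<le> V x) \<and>
           lipschitz_on_bounded V \<and>
           (\<forall>x. norm x powr p \<le> V x \<and> V x \<le> c * norm x powr p \<and>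
                V (blinfun_apply (J o\<^sub>L S T) x) \<le> \<mu> * V x)))"
proof -
  have S: "C0_semigroup S" using assms(1) by (simp add: generates_def)
  obtain K where "K \<ge> 1" and K: "\<And>t x. t \<in> {0..T} \<Longrightarrow> norm (blinfun_apply (S t) x) \<le> K * norm x"
    using growth_condition_semigroup_bound[OF S assms(4,5)] by metis
  let ?M = "blinfun_apply (J o\<^sub>L S T)"
  have lin: "linear ?M" by (intro bounded_linear.linear blinfun.bounded_linear_right)
  have UGES: "strongly_UGES S J (constant_dwell_sequences T) \<longleftrightarrow> geometrically_decaying ?M"
    by (rule strongly_UGES_iff_monodromy[OF S assms(4,5)])
  show ?thesis
    unfolding UGES
  proof (intro conjI iffI; (elim exE conjE)?)
    assume "geometrically_decaying ?M"
    then obtain c \<mu> V where "c \<ge> 1" "0 < \<mu>" "\<mu> < 1" "uniformly_lipschitz_on_bounded {0..T} V"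
      "\<And>x. continuous_on {0..T} (\<lambda>\<tau>. V \<tau> x)"
      "\<And>\<tau> x. \<tau> \<in> {0..T} \<Longrightarrow> norm x \<le> V \<tau> x" "\<And>\<tau> x. \<tau> \<in> {0..T} \<Longrightarrow> V \<tau> x \<le> c * norm x"
      "\<And>\<tau> x. \<tau> \<in> {0..<T} \<Longrightarrow> lower_right_Dini S V \<tau> x \<le> 0"
      "\<And>x. V 0 (blinfun_apply J x) \<le> \<mu> * V T x"
      using time_dependent_Lyapunov[OF S \<open>T > 0\<close> \<open>K \<ge> 1\<close> K] by metis
    moreover from this have "0 \<le> V \<tau> x" if "\<tau> \<in> {0..T}" for \<tau> x
      using that norm_ge_zero order_trans by blast
    ultimately show "\<exists>(p::real) (c::real) (\<eta>::real) (\<mu>::real) (V :: real \<Rightarrow> 'a \<Rightarrow> real).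
           p \<ge> 1 \<and> c \<ge> 1 \<and> \<eta> \<ge> 0 \<and> 0 < \<mu> \<and> \<mu> \<le> 1 \<and> \<eta> + (- ln \<mu>) > 0 \<and>
           (\<forall>\<tau>\<in>{0..T}. \<forall>x. 0 \<le> V \<tau> x) \<and>
           uniformly_lipschitz_on_bounded {0..T} V \<and>
           (\<forall>x. continuous_on {0..T} (\<lambda>\<tau>. V \<tau> x)) \<and>
           (\<forall>x. (\<forall>\<tau>\<in>{0..T}. norm x powr p \<le> V \<tau> x \<and> V \<tau> x \<le> c * norm x powr p) \<and>
                (\<forall>\<tau>\<in>{0..<T}. lower_right_Dini S V \<tau> x \<le> ereal (- \<eta> * V \<tau> x)) \<and>
                V 0 (blinfun_apply J x) \<le> \<mu> * V T x)"
      by (intro exI[of _ 1] exI[of _ c] exI[of _ 0] exI[of _ \<mu>] exI[of _ V])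
        (auto simp: zero_ereal_def)
  next
    fix p c \<eta> \<mu> :: real and V :: "real \<Rightarrow> 'a \<Rightarrow> real"
    assume *: "p \<ge> 1" "c \<ge> 1" "0 < \<mu>" and rate: "\<eta> \<ge> 0" "\<mu> \<le> 1" "\<eta> + (- ln \<mu>) > 0"
      and lip: "uniformly_lipschitz_on_bounded {0..T} V"
      and cont: "\<forall>x. continuous_on {0..T} (\<lambda>\<tau>. V \<tau> x)"
      and V: "\<forall>x. (\<forall>\<tau>\<in>{0..T}. norm x powr p \<le> V \<tau> x \<and> V \<tau> x \<le> c * norm x powr p) \<and>
                (\<forall>\<tau>\<in>{0..<T}. lower_right_Dini S V \<tau> x \<le> ereal (- \<eta> * V \<tau> x)) \<and>
                V 0 (blinfun_apply J x) \<le> \<mu> * V T x"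
    show "geometrically_decaying ?M"
    proof (rule geometrically_decaying_if_Lyapunov[OF *(1,2), of "\<mu> * exp (- \<eta> * T)" "V 0"])
      show "0 < \<mu> * exp (- \<eta> * T)" using * by simp
      \<comment> \<open>The two decay rates are not both zero, so the flow or the jump contributes.\<close>
      have "ln \<mu> \<le> 0" using * rate by simp
      have "\<eta> * T > 0 \<or> ln \<mu> < 0" using rate \<open>T > 0\<close> by (cases "\<eta> = 0") auto
      moreover have "\<eta> * T \<ge> 0" using rate \<open>T > 0\<close> by simp
      ultimately have "ln \<mu> - \<eta> * T < 0" using \<open>ln \<mu> \<le> 0\<close> by linarith
      moreover have "\<mu> * exp (- \<eta> * T) = exp (ln \<mu> - \<eta> * T)"
        using * by (simp add: exp_diff exp_minus divide_inverse)
      ultimately show "\<mu> * exp (- \<eta> * T) < 1" by simp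
      show "norm x powr p \<le> V 0 x" "V 0 x \<le> c * norm x powr p" for x
        using V \<open>T > 0\<close> by auto
      show "V 0 (?M x) \<le> \<mu> * exp (- \<eta> * T) * V 0 x" for x
        using cont V \<open>0 < \<mu>\<close> by (intro monodromy_decrease[OF S \<open>T > 0\<close> K lip]) auto
    qed
  next
    assume "geometrically_decaying ?M"
    then obtain c \<mu> V where V: "c \<ge> 1" "0 < \<mu>" "\<mu> < 1" "\<And>x. norm x \<le> V x" "\<And>x. V x \<le> c * norm x"
      "\<And>x. V (?M x) \<le> \<mu> * V x" "\<And>x y. V x \<le> V y + V (x - y)"
      using Lyapunov_if_geometrically_decaying[OF lin] by metis
    then have "0 \<le> V x" for x using norm_ge_zero order_trans by blast
    moreover have "lipschitz_on_bounded V"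
      unfolding lipschitz_on_bounded_def
      using V by (intro allI impI exI[of _ c] conjI lipschitz_if_subadditive) auto
    ultimately show "\<exists>(p::real) (c::real) (\<mu>::real) (V :: 'a \<Rightarrow> real).
           p \<ge> 1 \<and> c \<ge> 1 \<and> 0 < \<mu> \<and> \<mu> < 1 \<and>
           (\<forall>x. 0 \<le> V x) \<and>
           lipschitz_on_bounded V \<and>
           (\<forall>x. norm x powr p \<le> V x \<and> V x \<le> c * norm x powr p \<and>
                V (?M x) \<le> \<mu> * V x)"
      using V by (intro exI[of _ 1] exI[of _ c] exI[of _ \<mu>] exI[of _ V]) auto
  next
    fix p c \<mu> :: real and V :: "'a \<Rightarrow> real"
    assume "p \<ge> 1" "c \<ge> 1" "0 < \<mu>" "\<mu> < 1"
      and "\<forall>x. norm x powr p \<le> V x \<and> V x \<le> c * norm x powr p \<and> V (?M x) \<le> \<mu> * V x"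
    then show "geometrically_decaying ?M"
      by (intro geometrically_decaying_if_Lyapunov[of p c \<mu> V]) auto
  qed
qed

end
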